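(* Let $E$ be a Banach space over $\mathbb{K}$ ($\mathbb{K}=\mathbb{R}$ or $\mathbb{C}$) and let $F$ be an infinite-dimensional closed subspace of $E$. Then the following conditions are equivalent: (1) there exist a closed subspace $\mathcal{S}$ of $\ell_\infty$ with $c_0\subseteq\mathcal{S}$ and an $\mathcal{S}$-independent sequence $(x_n)_{n=1}^\infty$ of elements of $E$ such that $E\setminus F$ is $[(x_n)_{n=1}^\infty,\mathcal{S}]$-lineable; (2) $E\setminus F$ is spaceable; (3) $F$ has infinite codimension in $E$, i.e. $\dim(E/F)=\infty$.
   Context: All vector spaces are over $\mathbb{K}=\mathbb{R}$ or $\mathbb{C}$; "subspace" means vector subspace. The spaces $c_0\subseteq\ell_\infty\subseteq\mathbb{K}^{\mathbb{N}}$ are the usual spaces of null and bounded scalar sequences, and "closed subspace of $\ell_\infty$" refers to the supremum norm. Codimension is algebraic: $\dim(E/F)$. A subset $A$ of a topological vector space $E$ is spaceable if $A\cup\{0\}$ contains an infinite-dimensional closed subspace of $E$. Let $\mathcal{S}\neq\{0\}$ be a subspace of $\mathbb{K}^{\mathbb{N}}$. A sequence $(u_n)_{n=1}^\infty$ in a topological vector space $E$ is $\mathcal{S}$-independent if, whenever $(c_n)_{n=1}^\infty\in\mathcal{S}$ satisfies $\sum_{n=1}^\infty c_nu_n=0$ (convergent series), one has $c_n=0$ for all $n$. A subset $A$ of a Hausdorff topological vector space $E$ is $[(u_n)_{n=1}^\infty,\mathcal{S}]$-lineable (in $E$) if for each $(c_n)_{n=1}^\infty\in\mathcal{S}$ the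 series $\sum_{n=1}^\infty c_nu_n$ converges in $E$ to a vector in $A\cup\{0\}$. *)

theory Defs
  imports "HOL-Analysis.Analysis" "HOL-Library.Function_Algebras"
begin

text \<open>
  The type class \<open>banach\<close> only carries a real scalar multiplication. A Banach space over
  \<open>'k\<close> is a type of class \<open>banach\<close> with a scalar multiplication by \<open>'k\<close> that extends
  the real one and for which the given norm is absolutely homogeneous. For \<open>'k = real\<close>
  this forces \<open>smul = scaleR\<close>.
\<close>

locale banach_space_over = vector_space smul
  for smul :: "'k::real_normed_field \<Rightarrow> 'e::banach \<Rightarrow> 'e" +
  assumes scale_of_real: "smul (of_real r) x = r *\<^sub>R x"
    and norm_scale: "norm (smul a x) = norm a * norm x"

definition finite_dim :: "('k::field \<Rightarrow> 'e::ab_group_add \<Rightarrow> 'e) \<Rightarrow> 'e set \<Rightarrow> bool"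
  where "finite_dim smul V \<longleftrightarrow> (\<exists>B. finite B \<and> module.span smul B = V)"


subsection \<open>The quotient space \<open>E/F\<close>, with \<open>E\<close> the whole type\<close>

definition coset :: "'e::ab_group_add set \<Rightarrow> 'e \<Rightarrow> 'e set"
  where "coset F x = {x + y | y. y \<in> F}"

definition quotient_space :: "'e::ab_group_add set \<Rightarrow> 'e set set"
  where "quotient_space F = range (coset F)"

text \<open>
  The vector space operations of \<open>E/F\<close> are those induced on representatives:
  \<open>coset F 0\<close> is the zero vector, \<open>coset F x + coset F y = coset F (x + y)\<close> and
  \<open>a * coset F x = coset F (smul a x)\<close>.
\<close>

definition quotient_subspace ::
    "('k::field \<Rightarrow> 'e::ab_group_add \<Rightarrow> 'e) \<Rightarrow> 'e set \<Rightarrow> 'e set set \<Rightarrow> bool"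
  where "quotient_subspace smul F W \<longleftrightarrow>
    W \<subseteq> quotient_space F \<and>
    coset F 0 \<in> W \<and>
    (\<forall>x y. coset F x \<in> W \<longrightarrow> coset F y \<in> W \<longrightarrow> coset F (x + y) \<in> W) \<and>
    (\<forall>a x. coset F x \<in> W \<longrightarrow> coset F (smul a x) \<in> W)"

text \<open>
  \<open>quotient_subspace smul F hull B\<close> is the linear span of \<open>B\<close> in \<open>E/F\<close>, so this says
  that \<open>E/F\<close> is spanned by finitely many of its elements.
\<close>

definition finite_codim :: "('k::field \<Rightarrow> 'e::ab_group_add \<Rightarrow> 'e) \<Rightarrow> 'e set \<Rightarrow> bool"
  where "finite_codim smul F \<longleftrightarrow>
    (\<exists>B. finite B \<and> B \<subseteq> quotient_space F \<and>
         (quotient_subspace smul F hull B) = quotient_space F)"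


subsection \<open>Sequence spaces\<close>

definition l_infinity :: "(nat \<Rightarrow> 'k::real_normed_field) set"
  where "l_infinity = {c. bounded (range c)}"

definition c_null :: "(nat \<Rightarrow> 'k::real_normed_field) set"
  where "c_null = {c. c \<longlonglongrightarrow> 0}"

definition seq_scale :: "'k::field \<Rightarrow> (nat \<Rightarrow> 'k) \<Rightarrow> nat \<Rightarrow> 'k"
  where "seq_scale a c = (\<lambda>n. a * c n)"

text \<open>
  \<open>nat\<close> is discrete, so \<open>nat \<Rightarrow>\<^sub>C 'k\<close> is the space of all bounded sequences with the
  supremum norm.
\<close>

definition closed_subspace_l_infinity :: "(nat \<Rightarrow> 'k::real_normed_field) set \<Rightarrow> bool"
  where "closed_subspace_l_infinity S \<longleftrightarrow>
    S \<subseteq> l_infinity \<and> module.subspace seq_scale S \<and>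
    closed {f :: nat \<Rightarrow>\<^sub>C 'k. apply_bcontfun f \<in> S}"


subsection \<open>Spaceability, independence and lineability\<close>

text \<open>Sequences are indexed from 0 instead of 1.\<close>

definition spaceable ::
    "('k::field \<Rightarrow> 'e::{ab_group_add,topological_space} \<Rightarrow> 'e) \<Rightarrow> 'e set \<Rightarrow> bool"
  where "spaceable smul A \<longleftrightarrow>
    (\<exists>W. module.subspace smul W \<and> closed W \<and> \<not> finite_dim smul W \<and> W \<subseteq> A \<union> {0})"

definition seq_independent ::
    "('k::field \<Rightarrow> 'e::{ab_group_add,topological_space} \<Rightarrow> 'e) \<Rightarrow>
      (nat \<Rightarrow> 'k) set \<Rightarrow> (nat \<Rightarrow> 'e) \<Rightarrow> bool"
  where "seq_independent smul S u \<longleftrightarrow>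
    (\<forall>c\<in>S. (\<lambda>n. smul (c n) (u n)) sums 0 \<longrightarrow> (\<forall>n. c n = 0))"

definition seq_lineable ::
    "('k::field \<Rightarrow> 'e::{ab_group_add,t2_space} \<Rightarrow> 'e) \<Rightarrow>
      (nat \<Rightarrow> 'e) \<Rightarrow> (nat \<Rightarrow> 'k) set \<Rightarrow> 'e set \<Rightarrow> bool"
  where "seq_lineable smul u S A \<longleftrightarrow>
    (\<forall>c\<in>S. \<exists>x \<in> A \<union> {0}. (\<lambda>n. smul (c n) (u n)) sums x)"

end

theory Submission
  imports Defs
begin

text \<open>
  A sequence with \<open>u n \<notin> span (F \<union> u ` {..<n})\<close> is incompatible with finite codimension of \<open>F\<close>,
  by the exchange lemma. A lineable independent sequence is such a sequence (test it on finitely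
  supported coefficients), and an infinite-dimensional subspace meeting \<open>F\<close> in \<open>0\<close> contains one.

  Conversely, if \<open>F\<close> has infinite codimension, the Hahn--Banach theorem yields vectors \<open>w n\<close> and
  continuous functionals \<open>f n\<close> vanishing on \<open>F\<close> with \<open>f n (w n) \<noteq> 0\<close> and \<open>f n (w m) = 0\<close> for
  \<open>n < m\<close>. Rescaled to have summable norms, the \<open>w n\<close> show lineability with \<open>\<S> = \<ell>\<^sub>\<infinity>\<close>: applying
  \<open>f 0\<close>, \<open>f 1\<close>, \<dots> to a sum in \<open>F\<close> kills its coefficients one after another. In the same way, a
  vector of \<open>F\<close> in the closed span of the \<open>w n\<close> lies in the closed span of every tail \<open>w n, w (n + 1), \<dots>\<close>.
  As the closed span is separable, it has a countable total family of functionals \<open>g j\<close>; choosing the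
  \<open>w n\<close> with \<open>g j (w n) = 0\<close> for \<open>j < n\<close> forces such a vector to be \<open>0\<close>.
\<close>

subsection \<open>The Hahn--Banach theorem\<close>

text \<open>
  The sublinear functionals below a given one, ordered pointwise, contain a minimal element by Zorn's
  lemma. Minimal ones are linear because \<open>slide q y\<close> is again sublinear, below \<open>q\<close>, and at most
  \<open>- q y\<close> at \<open>- y\<close>.
\<close>

definition sublinear :: "('a::real_vector \<Rightarrow> real) \<Rightarrow> bool"
  where "sublinear q \<longleftrightarrow>
    (\<forall>x y. q (x + y) \<le> q x + q y) \<and> (\<forall>r>0. \<forall>x. q (r *\<^sub>R x) = r * q x)"

text \<open>The inequality for the factor \<open>1/r\<close> at the vector \<open>r x\<close> is the
  reverse inequality for \<open>r\<close> at \<open>x\<close>.\<close>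

lemma sublinearI:
  assumes "\<And>x y. q (x + y) \<le> q x + q y" and le: "\<And>r x. r > 0 \<Longrightarrow> q (r *\<^sub>R x) \<le> r * q x"
  shows "sublinear q"
proof -
  have "q (r *\<^sub>R x) = r * q x" if r: "r > 0" for r x
  proof (rule antisym)
    have "q ((1/r) *\<^sub>R (r *\<^sub>R x)) \<le> (1/r) * q (r *\<^sub>R x)"
      using r by (intro le) simp
    then show "r * q x \<le> q (r *\<^sub>R x)"
      using r by (simp add: field_simps)
  qed (rule le[OF r])
  then show ?thesis using assms(1) by (simp add: sublinear_def)
qed

lemma sublinear_add: "sublinear q \<Longrightarrow> q (x + y) \<le> q x + q y"
  by (simp add: sublinear_def)

lemma sublinear_zero:
  assumes "sublinear q"
  shows "q 0 = 0"
proof -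
  have "q (2 *\<^sub>R 0) = 2 * q 0"
    using assms unfolding sublinear_def by (metis zero_less_numeral)
  then show ?thesis by simp
qed

lemma sublinear_scale:
  assumes "sublinear q" "r \<ge> 0"
  shows "q (r *\<^sub>R x) = r * q x"
proof (cases "r = 0")
  case True
  then show ?thesis using sublinear_zero[OF assms(1)] by simp
next
  case False
  then show ?thesis using assms by (simp add: sublinear_def)
qed

lemma sublinear_minus: "sublinear q \<Longrightarrow> - q (- x) \<le> q x"
  using sublinear_add[of q x "- x"] sublinear_zero[of q] by simp

text \<open>For sublinear \<open>q\<close> this is the largest sublinear functional below
  \<open>q\<close> whose value at \<open>- y\<close> is at most \<open>- q y\<close>.\<close>

definition slide :: "('a::real_vector \<Rightarrow> real) \<Rightarrow> 'a \<Rightarrow> 'a \<Rightarrow> real"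
  where "slide q y x = (INF t\<in>{0..}. q (x + t *\<^sub>R y) - t * q y)"

lemma slide_le:
  assumes q: "sublinear q" and t: "t \<ge> 0"
  shows "slide q y x \<le> q (x + t *\<^sub>R y) - t * q y"
  unfolding slide_def
proof (rule cINF_lower)
  \<comment> \<open>A real \<open>INF\<close> is informative only for a set bounded below.
    Subadditivity on \<open>s y = - x + (x + s y)\<close> gives a bound independent of
    \<open>s\<close>.\<close>
  have "- q (- x) \<le> q (x + s *\<^sub>R y) - s * q y" if "s \<ge> 0" for s
    using sublinear_add[OF q, of "- x" "x + s *\<^sub>R y"] sublinear_scale[OF q that, of y] by simp
  then show "bdd_below ((\<lambda>t. q (x + t *\<^sub>R y) - t * q y) ` {0..})"
    by (intro bdd_belowI[of _ "- q (- x)"]) auto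
qed (use t in simp)

lemma slide_greatest:
  assumes "\<And>t. t \<ge> 0 \<Longrightarrow> m \<le> q (x + t *\<^sub>R y) - t * q y"
  shows "m \<le> slide q y x"
  unfolding slide_def using assms by (intro cINF_greatest) auto

lemma slide_le_self: "sublinear q \<Longrightarrow> slide q y x \<le> q x"
  using slide_le[of q 0 y x] by simp

lemma slide_minus: "sublinear q \<Longrightarrow> slide q y (- y) \<le> - q y"
  using slide_le[of q 1 y "- y"] sublinear_zero[of q] by simp

text \<open>Shifts combine: \<open>s\<close> for \<open>x\<close> and \<open>t\<close> for
  \<open>x'\<close> give the candidate \<open>s + t\<close> for \<open>x + x'\<close>, and
  \<open>t\<close> for \<open>x\<close> gives \<open>r * t\<close> for \<open>r x\<close>. The
  infima over \<open>s\<close> and \<open>t\<close> are then taken one after the other.\<close>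

lemma sublinear_slide:
  assumes q: "sublinear q"
  shows "sublinear (slide q y)"
proof (rule sublinearI)
  fix x x'
  have "slide q y (x + x') - (q (x + s *\<^sub>R y) - s * q y) \<le> slide q y x'" if s: "s \<ge> 0" for s
  proof (rule slide_greatest)
    fix t :: real assume t: "t \<ge> 0"
    have "slide q y (x + x') \<le> q ((x + s *\<^sub>R y) + (x' + t *\<^sub>R y)) - (s + t) * q y"
      using slide_le[OF q, of "s + t" y "x + x'"] s t by (simp add: algebra_simps)
    also have "\<dots> \<le> q (x + s *\<^sub>R y) + q (x' + t *\<^sub>R y) - (s + t) * q y"
      using sublinear_add[OF q] by simp
    finally show "slide q y (x + x') - (q (x + s *\<^sub>R y) - s * q y) \<le> q (x' + t *\<^sub>R y) - t * q y"
      by (simp add: algebra_simps)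
  qed
  then have "slide q y (x + x') - slide q y x' \<le> slide q y x"
    by (intro slide_greatest) (simp add: algebra_simps)
  then show "slide q y (x + x') \<le> slide q y x + slide q y x'" by simp
next
  fix r :: real and x assume r: "r > 0"
  have "slide q y (r *\<^sub>R x) / r \<le> slide q y x"
  proof (rule slide_greatest)
    fix t :: real assume t: "t \<ge> 0"
    have "slide q y (r *\<^sub>R x) \<le> q (r *\<^sub>R (x + t *\<^sub>R y)) - r * t * q y"
      using slide_le[OF q, of "r * t" y "r *\<^sub>R x"] r t by (simp add: algebra_simps)
    also have "\<dots> = r * (q (x + t *\<^sub>R y) - t * q y)"
      using sublinear_scale[OF q, of r "x + t *\<^sub>R y"] r by (simp add: right_diff_distrib)
    finally show "slide q y (r *\<^sub>R x) / r \<le> q (x + t *\<^sub>R y) - t * q y"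
      using r by (simp add: field_simps)
  qed
  then show "slide q y (r *\<^sub>R x) \<le> r * slide q y x" using r by (simp add: field_simps)
qed

text \<open>Minimality yields \<open>slide q y = q\<close> for every \<open>y\<close>, so
  \<open>q\<close> is odd. Oddness turns subadditivity and positive homogeneity into
  linearity.\<close>

lemma minimal_sublinear_imp_linear:
  assumes q: "sublinear q" and min: "\<And>q'. sublinear q' \<Longrightarrow> q' \<le> q \<Longrightarrow> q' = q"
  shows "linear q"
proof -
  have minus: "q (- y) = - q y" for y
  proof -
    have "slide q y = q"
      using sublinear_slide[OF q] slide_le_self[OF q] by (intro min) (auto simp: le_fun_def)
    then have "q (- y) \<le> - q y" using slide_minus[OF q, of y] by simp
    with sublinear_minus[OF q, of y] show ?thesis by simp
  qed
  show ?thesis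
  proof (rule linearI)
    fix x y
    show "q (x + y) = q x + q y"
      using sublinear_add[OF q, of x y] sublinear_add[OF q, of "- x" "- y"] minus[of "x + y"]
        minus[of x] minus[of y] by simp
  next
    fix r :: real and x
    show "q (r *\<^sub>R x) = r *\<^sub>R q x"
    proof (cases "r \<ge> 0")
      case False
      then show ?thesis using sublinear_scale[OF q, of "- r" x] minus[of "r *\<^sub>R x"] by simp
    qed (simp add: sublinear_scale[OF q])
  qed
qed

text \<open>These infima are the bounds that Zorn's lemma asks for. In a chain, \<open>f x\<close>
  and \<open>g y\<close> can both be replaced by values of the smaller functional, to which
  subadditivity applies.\<close>

lemma sublinear_INF_chain:
  assumes ne: "C \<noteq> {}" and C: "\<And>q. q \<in> C \<Longrightarrow> sublinear q \<and> q \<le> p"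
    and chain: "\<And>f g. f \<in> C \<Longrightarrow> g \<in> C \<Longrightarrow> f \<le> g \<or> g \<le> f"
  shows "sublinear (\<lambda>x. INF q\<in>C. q x)" and "\<And>q x. q \<in> C \<Longrightarrow> (INF q\<in>C. q x) \<le> q x"
proof -
  have "- p (- x) \<le> q x" if "q \<in> C" for q x
    using sublinear_minus[of q x] C[OF that] le_funD[of q p "- x"] by simp
  then show lower: "(INF q\<in>C. q x) \<le> q x" if "q \<in> C" for q x
    using that by (intro cINF_lower bdd_belowI[of _ "- p (- x)"]) auto
  show "sublinear (\<lambda>x. INF q\<in>C. q x)"
  proof (rule sublinearI)
    fix x y
    have *: "(INF q\<in>C. q (x + y)) \<le> f x + g y" if fg: "f \<in> C" "g \<in> C" for f g
    proof -
      obtain h where h: "h \<in> C" "h \<le> f" "h \<le> g" using chain[OF fg] fg by auto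
      have "(INF q\<in>C. q (x + y)) \<le> h (x + y)" by (rule lower[OF h(1)])
      also have "\<dots> \<le> h x + h y" using C[OF h(1)] by (simp add: sublinear_add)
      also have "\<dots> \<le> f x + g y" using h by (simp add: le_fun_def add_mono)
      finally show ?thesis .
    qed
    have "(INF q\<in>C. q (x + y)) - f x \<le> (INF q\<in>C. q y)" if "f \<in> C" for f
      using *[OF that] ne by (intro cINF_greatest) (auto simp: algebra_simps)
    then have "(INF q\<in>C. q (x + y)) - (INF q\<in>C. q y) \<le> (INF q\<in>C. q x)"
      using ne by (intro cINF_greatest) (auto simp: algebra_simps)
    then show "(INF q\<in>C. q (x + y)) \<le> (INF q\<in>C. q x) + (INF q\<in>C. q y)" by simp
  next
    fix r :: real and x assume r: "r > 0"
    have "(INF q\<in>C. q (r *\<^sub>R x)) / r \<le> f x" if "f \<in> C" for f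
      using lower[OF that, of "r *\<^sub>R x"] C[OF that] r
      by (simp add: sublinear_scale field_simps)
    then have "(INF q\<in>C. q (r *\<^sub>R x)) / r \<le> (INF q\<in>C. q x)"
      using ne by (intro cINF_greatest) auto
    then show "(INF q\<in>C. q (r *\<^sub>R x)) \<le> r * (INF q\<in>C. q x)" using r by (simp add: field_simps)
  qed
qed

lemma ex_linear_le_sublinear:
  assumes p: "sublinear p"
  shows "\<exists>f. linear f \<and> f \<le> p"
proof -
  define A where "A = {q. sublinear q \<and> q \<le> p}"
  \<comment> \<open>Zorn's lemma is used for the reversed order, so that a maximal element is a
    minimal functional.\<close>
  have "\<exists>m\<in>A. \<forall>a\<in>A. m \<ge> a \<longrightarrow> a = m"
  proof (rule predicate_Zorn)
    show "partial_order_on A (relation_of (\<ge>) A)"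
      by (rule partial_order_on_relation_ofI) auto
    fix C assume C: "C \<in> Chains (relation_of (\<ge>) A)"
    show "\<exists>u\<in>A. \<forall>a\<in>C. a \<ge> u"
    proof (cases "C = {}")
      \<comment> \<open>An \<open>INF\<close> over the empty chain carries no information, so
        \<open>p\<close> itself serves as the bound.\<close>
      case True
      then show ?thesis using p by (auto simp: A_def)
    next
      case False
      have CA: "q \<in> A" if "q \<in> C" for q
        using C that by (auto simp: Chains_def relation_of_def)
      have chain: "f \<le> g \<or> g \<le> f" if "f \<in> C" "g \<in> C" for f g
        using C that by (auto simp: Chains_def relation_of_def)
      let ?u = "\<lambda>x. INF q\<in>C. q x"
      have u: "sublinear ?u" and le: "\<And>q. q \<in> C \<Longrightarrow> ?u \<le> q"
        using sublinear_INF_chain[OF False, of p] CA chain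
        by (auto simp: A_def le_fun_def)
      obtain q where "q \<in> C" using False by auto
      then have "?u \<le> p" using le[of q] CA[of q] by (auto simp: A_def intro: order_trans)
      with u le show ?thesis by (auto simp: A_def)
    qed
  qed
  then obtain m where m: "sublinear m" "m \<le> p"
    and min: "\<And>q. sublinear q \<Longrightarrow> q \<le> p \<Longrightarrow> q \<le> m \<Longrightarrow> q = m"
    unfolding A_def by blast
  have "linear m" using m order_trans by (intro minimal_sublinear_imp_linear min) auto
  with m show ?thesis by blast
qed

text \<open>Domination by \<open>slide p w\<close> instead of \<open>p\<close> gives
  \<open>f (- w) \<le> - p w\<close>, which forces equality at \<open>w\<close>.\<close>

theorem hahn_banach_sublinear:
  assumes p: "sublinear p"
  obtains f where "linear f" "f \<le> p" "f w = p w"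
proof -
  obtain f where f: "linear f" "f \<le> slide p w"
    using ex_linear_le_sublinear[OF sublinear_slide[OF p]] by blast
  then have le: "f x \<le> p x" for x
    using slide_le_self[OF p, of w x] by (auto simp: le_fun_def intro: order_trans)
  have "- f w \<le> - p w"
    using le_funD[OF f(2), of "- w"] slide_minus[OF p, of w] linear_neg[OF f(1), of w] by simp
  with le[of w] have "f w = p w" by simp
  with f le show ?thesis using that by (auto simp: le_fun_def)
qed

subsection \<open>Closed subspaces of Banach spaces over \<open>'k\<close>\<close>

context banach_space_over
begin

text \<open>The distance to a subspace is the seminorm of the quotient by it; its triangle
  inequality comes from adding approximating points of \<open>F\<close>.\<close>

lemma infdist_add_le:
  assumes F: "subspace F"
  shows "infdist (x + y) F \<le> infdist x F + infdist y F"
proof -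
  have ne: "F \<noteq> {}" using subspace_0[OF F] by auto
  have *: "infdist (x + y) F \<le> dist x a + dist y b" if "a \<in> F" "b \<in> F" for a b
  proof -
    have "infdist (x + y) F \<le> dist (x + y) (a + b)"
      by (intro infdist_le subspace_add F that)
    also have "\<dots> \<le> dist x a + dist y b" by (rule dist_triangle_add)
    finally show ?thesis .
  qed
  have "infdist (x + y) F - dist x a \<le> infdist y F" if "a \<in> F" for a
    unfolding infdist_notempty[OF ne, of y]
    using *[OF that] ne by (intro cINF_greatest) (auto simp: algebra_simps)
  then have "infdist (x + y) F - infdist y F \<le> infdist x F"
    unfolding infdist_notempty[OF ne, of x]
    using ne by (intro cINF_greatest) (auto simp: algebra_simps)
  then show ?thesis by simp
qed

lemma infdist_scale_le:
  assumes F: "subspace F"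
  shows "infdist (smul a x) F \<le> norm a * infdist x F"
proof (cases "a = 0")
  case True
  then show ?thesis using subspace_0[OF F] by simp
next
  case False
  have ne: "F \<noteq> {}" using subspace_0[OF F] by auto
  have "infdist (smul a x) F / norm a \<le> dist x y" if "y \<in> F" for y
  proof -
    have "infdist (smul a x) F \<le> dist (smul a x) (smul a y)"
      by (intro infdist_le subspace_scale F that)
    also have "\<dots> = norm a * dist x y"
      by (simp add: dist_norm norm_scale flip: scale_right_diff_distrib)
    finally show ?thesis using False by (simp add: field_simps)
  qed
  then have "infdist (smul a x) F / norm a \<le> infdist x F"
    unfolding infdist_notempty[OF ne, of x] using ne by (intro cINF_greatest) auto
  then show ?thesis using False by (simp add: field_simps)
qed

lemma infdist_le_norm: "subspace F \<Longrightarrow> infdist x F \<le> norm x"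
  using infdist_le[of 0 F x] subspace_0[of F] by simp

text \<open>Domination by the distance, rather than by the norm, makes \<open>f\<close> bounded and
  zero on \<open>F\<close> at the same time.\<close>

lemma hahn_banach_infdist:
  assumes F: "subspace F"
  obtains f :: "'e \<Rightarrow> real"
  where "linear f" "\<And>x. \<bar>f x\<bar> \<le> infdist x F" "f w = infdist w F"
proof -
  have "infdist (r *\<^sub>R x) F \<le> r * infdist x F" if "r > 0" for r x
    using infdist_scale_le[OF F, of "of_real r" x] that by (simp add: scale_of_real)
  then have "sublinear (\<lambda>x. infdist x F)"
    by (intro sublinearI infdist_add_le F)
  then obtain f where f: "linear f" "f \<le> (\<lambda>x. infdist x F)" "f w = infdist w F"
    by (rule hahn_banach_sublinear)
  have "\<bar>f x\<bar> \<le> infdist x F" for x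
  proof -
    have "infdist (- x) F \<le> infdist x F"
      using infdist_scale_le[OF F, of "- 1" x] by (simp add: scale_minus_left)
    moreover have "f y \<le> infdist y F" for y using f(2) by (simp add: le_fun_def)
    ultimately show ?thesis
      using linear_neg[OF f(1), of x] by (metis abs_le_iff order_trans)
  qed
  with f show ?thesis using that by blast
qed

text \<open>\<open>bounded_linear\<close> speaks of real scalars only, so homogeneity over
  \<open>'k\<close> is added.\<close>

definition functional :: "('e \<Rightarrow> 'k) \<Rightarrow> bool"
  where "functional f \<longleftrightarrow> bounded_linear f \<and> (\<forall>a x. f (smul a x) = a * f x)"

end

text \<open>The factor \<open>2\<close> leaves room for the complexification \<open>x \<mapsto> f x - i f (i x)\<close>
  of a real functional \<open>f\<close>.\<close>

locale hahn_banach_space =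
  banach_space_over smul
  for smul :: "'k::{real_normed_field,second_countable_topology} \<Rightarrow> 'e::banach \<Rightarrow> 'e" +
  assumes separation: "subspace F \<Longrightarrow>
    \<exists>f. functional f \<and> (\<forall>x. norm (f x) \<le> 2 * infdist x F) \<and> infdist w F \<le> norm (f w)"

lemma hahn_banach_space_real: "hahn_banach_space (scaleR :: real \<Rightarrow> 'e::banach \<Rightarrow> 'e)"
proof -
  interpret b: banach_space_over "scaleR :: real \<Rightarrow> 'e \<Rightarrow> 'e"
    by unfold_locales (auto simp: algebra_simps)
  show ?thesis
  proof
    fix F :: "'e set" and w assume F: "module.subspace scaleR F"
    obtain f where f: "linear f" "\<And>x. \<bar>f x\<bar> \<le> infdist x F" "f w = infdist w F"
      using b.hahn_banach_infdist[OF F] by blast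
    have "\<bar>f x\<bar> \<le> norm x" for x using f(2)[of x] b.infdist_le_norm[OF F, of x] by simp
    then have "bounded_linear f"
      using f(1) by (intro bounded_linear.intro bounded_linear_axioms.intro) (auto intro!: exI[of _ 1])
    moreover have "norm (f x) \<le> 2 * infdist x F" for x
      using f(2)[of x] infdist_nonneg[of x F] unfolding real_norm_def by linarith
    ultimately show "\<exists>f. b.functional f \<and> (\<forall>x. norm (f x) \<le> 2 * infdist x F) \<and> infdist w F \<le> norm (f w)"
      using f by (intro exI[of _ f]) (auto simp: b.functional_def linear_scale infdist_nonneg)
  qed
qed

lemma hahn_banach_space_complex:
  fixes scaleC :: "complex \<Rightarrow> 'f::banach \<Rightarrow> 'f"
  assumes "banach_space_over scaleC"
  shows "hahn_banach_space scaleC"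
proof -
  interpret b: banach_space_over scaleC by (rule assms)
  show ?thesis
  proof
    fix F :: "'f set" and w assume F: "b.subspace F"
    obtain f where f: "linear f" "\<And>x. \<bar>f x\<bar> \<le> infdist x F" "f w = infdist w F"
      using b.hahn_banach_infdist[OF F] by blast
    \<comment> \<open>With \<open>f\<close> as real part, the imaginary part is forced by
      \<open>g (i x) = i g x\<close>.\<close>
    define g where "g x = Complex (f x) (- f (scaleC \<i> x))" for x
    have g_add: "g (x + y) = g x + g y" for x y
      by (simp add: g_def complex_eq_iff linear_add[OF f(1)] b.scale_right_distrib)
    have g_scale: "g (scaleC a x) = a * g x" for a x
    proof -
      have 1: "f (scaleC c x) = Re c * f x + Im c * f (scaleC \<i> x)" for c
      proof -
        have "scaleC c x = scaleC (of_real (Re c)) x + scaleC (of_real (Im c)) (scaleC \<i> x)"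
          by (metis b.scale_left_distrib b.scale_scale complex_eq mult.commute)
        then show ?thesis
          by (simp only: b.scale_of_real linear_add[OF f(1)] linear_scale[OF f(1)] real_scaleR_def)
      qed
      \<comment> \<open>\<open>c = a\<close> settles the real part and \<open>c = i a\<close> the
        imaginary part.\<close>
      show ?thesis using 1[of a] 1[of "\<i> * a"] by (simp add: g_def complex_eq_iff)
    qed
    have g_le: "norm (g x) \<le> 2 * infdist x F" for x
    proof -
      have "norm (g x) \<le> \<bar>f x\<bar> + \<bar>f (scaleC \<i> x)\<bar>"
        using cmod_le[of "g x"] by (simp add: g_def)
      also have "\<dots> \<le> infdist x F + infdist (scaleC \<i> x) F" by (intro add_mono f)
      also have "\<dots> \<le> 2 * infdist x F" using b.infdist_scale_le[OF F, of \<i> x] by simp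
      finally show ?thesis .
    qed
    have "g (r *\<^sub>R x) = r *\<^sub>R g x" for r x
      using g_scale[of "of_real r" x] by (simp add: b.scale_of_real scaleR_conv_of_real)
    moreover have "norm (g x) \<le> norm x * 2" for x
      using g_le[of x] b.infdist_le_norm[OF F, of x] by simp
    ultimately have "bounded_linear g" using g_add by (intro bounded_linear_intro)
    moreover have "infdist w F \<le> norm (g w)"
      using complex_Re_le_cmod[of "g w"] f(3) by (simp add: g_def)
    ultimately show "\<exists>f. b.functional f \<and> (\<forall>x. norm (f x) \<le> 2 * infdist x F) \<and> infdist w F \<le> norm (f w)"
      using g_scale g_le by (auto simp: b.functional_def)
  qed
qed

subsection \<open>Finite codimension\<close>

context vector_space
begin

text \<open>If adjoining \<open>b\<close> to \<open>F\<close> preserves the hypothesis on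
  \<open>u\<close>, the induction hypothesis applies to the enlarged set. Otherwise \<open>b\<close>
  can be exchanged for some \<open>u n\<close>: it lies in the span of \<open>F\<close> and the
  terms up to \<open>u n\<close>, and the induction continues with these adjoined to
  \<open>F\<close> and the tail of \<open>u\<close> after \<open>n\<close>.\<close>

lemma not_subset_span_Un_finite:
  fixes u :: "nat \<Rightarrow> 'b"
  assumes "finite B" and "\<And>n. u n \<notin> span (F \<union> u ` {..<n})"
  shows "\<not> range u \<subseteq> span (F \<union> B)"
  using assms
proof (induction B arbitrary: F u)
  case empty
  from empty[of 0] show ?case by auto
next
  case (insert b B)
  show ?case
  proof
    assume range: "range u \<subseteq> span (F \<union> insert b B)"
    show False
    proof (cases "\<exists>n. u n \<in> span (insert b F \<union> u ` {..<n})")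
      case True
      then obtain n where n: "u n \<in> span (insert b (F \<union> u ` {..<n}))" by auto
      define F' where "F' = F \<union> u ` {..n}"
      have "b \<in> span (insert (u n) (F \<union> u ` {..<n}))"
        by (rule in_span_insert[OF n insert.prems])
      also have "insert (u n) (F \<union> u ` {..<n}) = F'"
        by (simp add: F'_def lessThan_Suc flip: lessThan_Suc_atMost)
      finally have "F \<union> insert b B \<subseteq> span (F' \<union> B)"
        using span_mono[of F' "F' \<union> B"] span_superset[of "F' \<union> B"] by (auto simp: F'_def)
      then have "span (F \<union> insert b B) \<subseteq> span (F' \<union> B)"
        by (intro span_minimal) auto
      moreover have "u (m + Suc n) \<notin> span (F' \<union> (\<lambda>m. u (m + Suc n)) ` {..<m})" for m
      proof -
        have "u ` {..<m + Suc n} = u ` {..n} \<union> (\<lambda>m. u (m + Suc n)) ` {..<m}"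
        proof -
          have "{..<m + Suc n} = {..n} \<union> (\<lambda>m. m + Suc n) ` {..<m}"
          proof (intro equalityI subsetI)
            fix k assume "k \<in> {..<m + Suc n}"
            then show "k \<in> {..n} \<union> (\<lambda>m. m + Suc n) ` {..<m}"
              by (cases "k \<le> n") (auto intro!: image_eqI[of _ _ "k - Suc n"])
          qed auto
          then show ?thesis by (simp add: image_Un image_image)
        qed
        then show ?thesis using insert.prems[of "m + Suc n"] by (simp add: F'_def Un_assoc)
      qed
      then have "\<not> range (\<lambda>m. u (m + Suc n)) \<subseteq> span (F' \<union> B)" by (rule insert.IH)
      ultimately show False using range by blast
    next
      case False
      then have "\<not> range u \<subseteq> span (insert b F \<union> B)" by (intro insert.IH) auto
      with range show False by simp
    qed
  qed
qed

lemma mem_coset_iff: "y \<in> coset F x \<longleftrightarrow> y - x \<in> F"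
  unfolding coset_def by (auto intro!: exI[of _ "y - x"])

text \<open>Finite spanning sets of the quotient are traded for finite sets of representatives, so
  that later arguments take place in the space itself.\<close>

lemma finite_codim_iff:
  assumes F: "subspace F"
  shows "finite_codim scale F \<longleftrightarrow> (\<exists>B. finite B \<and> span (F \<union> B) = UNIV)"
proof
  assume "finite_codim scale F"
  then obtain B where B: "finite B" "B \<subseteq> quotient_space F"
      "(quotient_subspace scale F hull B) = quotient_space F"
    by (auto simp: finite_codim_def)
  then obtain R where R: "finite R" "B = coset F ` R"
    unfolding quotient_space_def by (metis finite_subset_image subset_UNIV)
  define V where "V = span (F \<union> R)"
  \<comment> \<open>\<open>V\<close> contains \<open>F\<close> and is therefore a union of cosets,
    so membership in it can be tested in the quotient.\<close>
  have V: "x \<in> V" if "coset F x \<in> coset F ` V" for x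
  proof -
    from that obtain y where y: "coset F x = coset F y" "y \<in> V" by auto
    have "x \<in> coset F y"
      unfolding y(1)[symmetric] using subspace_0[OF F] by (simp add: mem_coset_iff)
    then have "x - y \<in> V" by (simp add: mem_coset_iff V_def span_base)
    then have "(x - y) + y \<in> V" unfolding V_def by (intro span_add) (use y in \<open>auto simp: V_def\<close>)
    then show ?thesis by simp
  qed
  have "subspace V" by (simp add: V_def)
  then have "coset F (x + y) \<in> coset F ` V" if "coset F x \<in> coset F ` V" "coset F y \<in> coset F ` V" for x y
    using V[OF that(1)] V[OF that(2)] by (intro imageI subspace_add)
  moreover have "coset F (scale a x) \<in> coset F ` V" if "coset F x \<in> coset F ` V" for a x
    using V[OF that] \<open>subspace V\<close> by (intro imageI subspace_scale)
  moreover have "coset F 0 \<in> coset F ` V"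
    using subspace_0[OF \<open>subspace V\<close>] by (rule imageI)
  ultimately have "quotient_subspace scale F (coset F ` V)"
    unfolding quotient_subspace_def quotient_space_def by blast
  moreover have "B \<subseteq> coset F ` V" by (auto simp: R V_def intro: span_base)
  ultimately have "quotient_space F \<subseteq> coset F ` V"
    using hull_minimal B(3) by metis
  then have "x \<in> V" for x using V[of x] unfolding quotient_space_def by blast
  then have "V = UNIV" by blast
  with R show "\<exists>B. finite B \<and> span (F \<union> B) = UNIV" by (auto simp: V_def)
next
  assume "\<exists>B. finite B \<and> span (F \<union> B) = UNIV"
  then obtain B where B: "finite B" "span (F \<union> B) = UNIV" by auto
  have "quotient_space F \<subseteq> W" if W: "coset F ` B \<subseteq> W" "quotient_subspace scale F W" for W
  proof -
    have "coset F f = coset F 0" if f: "f \<in> F" for f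
    proof -
      have "y - f \<in> F \<longleftrightarrow> y \<in> F" for y
        using subspace_add[OF F _ f, of "y - f"] subspace_diff[OF F _ f, of y] by auto
      then show ?thesis by (auto simp: mem_coset_iff)
    qed
    then have "F \<union> B \<subseteq> {x. coset F x \<in> W}"
      using W by (auto simp: quotient_subspace_def)
    moreover have "subspace {x. coset F x \<in> W}"
      using W(2) by (auto simp: quotient_subspace_def subspace_def)
    ultimately have "span (F \<union> B) \<subseteq> {x. coset F x \<in> W}" by (rule span_minimal)
    then show ?thesis using B by (auto simp: quotient_space_def)
  qed
  moreover have "quotient_subspace scale F (quotient_space F)"
    by (auto simp: quotient_subspace_def quotient_space_def)
  ultimately have "(quotient_subspace scale F hull (coset F ` B)) = quotient_space F"
    by (intro hull_unique) (auto simp: quotient_space_def)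
  then show "finite_codim scale F"
    using B by (auto simp: finite_codim_def quotient_space_def intro!: exI[of _ "coset F ` B"])
qed

end

section \<open>Lineability or spaceability of the complement forces infinite codimension\<close>

context banach_space_over
begin

lemma in_span_UnE:
  assumes F: "subspace F" and x: "x \<in> span (F \<union> A)"
  obtains f s where "f \<in> F" "s \<in> span A" "x = f + s"
proof -
  have "span F = F" using F by simp
  then show ?thesis using x that unfolding span_Un by blast
qed

text \<open>\<open>W\<close> meets \<open>F\<close> only in \<open>0\<close>, so linearly
  independent vectors of \<open>W\<close> stay independent modulo \<open>F\<close>.\<close>

lemma spaceable_imp_infinite_codim:
  assumes F: "subspace F" and sp: "spaceable smul (UNIV - F)"
  shows "\<not> finite_codim smul F"
proof -
  obtain W where W: "subspace W" "\<not> finite_dim smul W" "W \<subseteq> (UNIV - F) \<union> {0}"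
    using sp by (auto simp: spaceable_def)
  \<comment> \<open>No finite set spans \<open>W\<close>, so a next vector always exists. The second
    goal of the choice rule checks that the condition depends on earlier terms only.\<close>
  have "\<exists>u. \<forall>n::nat. u n \<in> W \<and> u n \<notin> span (u ` {..<n})"
  proof (rule dependent_wellorder_choice)
    fix n :: nat and u assume u: "\<And>m. m < n \<Longrightarrow> u m \<in> W \<and> u m \<notin> span (u ` {..<m})"
    then have "span (u ` {..<n}) \<subseteq> W" by (intro span_minimal W) auto
    moreover have "span (u ` {..<n}) \<noteq> W" using W(2) by (auto simp: finite_dim_def)
    ultimately show "\<exists>r. r \<in> W \<and> r \<notin> span (u ` {..<n})" by auto
  next
    fix r :: 'e and f g :: "nat \<Rightarrow> 'e" and n assume "\<And>m. m < n \<Longrightarrow> f m = g m"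
    then have "f ` {..<n} = g ` {..<n}" by (intro image_cong) auto
    then show "(r \<in> W \<and> r \<notin> span (f ` {..<n})) = (r \<in> W \<and> r \<notin> span (g ` {..<n}))" by simp
  qed
  then obtain u where u: "\<And>n::nat. u n \<in> W" "\<And>n. u n \<notin> span (u ` {..<n})" by auto
  have "u n \<notin> span (F \<union> u ` {..<n})" for n
  proof
    assume "u n \<in> span (F \<union> u ` {..<n})"
    then obtain f s where fs: "f \<in> F" "s \<in> span (u ` {..<n})" "u n = f + s"
      by (rule in_span_UnE[OF F])
    have "s \<in> W" using fs(2) span_minimal[of "u ` {..<n}" W] u W(1) by auto
    then have "u n - s \<in> W" by (intro subspace_diff W u)
    then have "f = 0" using fs W(3) by auto
    with fs u(2)[of n] show False by simp
  qed
  then have "span (F \<union> B) \<noteq> UNIV" if "finite B" for B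
    using not_subset_span_Un_finite[OF that, of u F] by auto
  then show ?thesis using finite_codim_iff[OF F] by auto
qed

text \<open>A relation \<open>x n = f + s\<close>, with \<open>s\<close> a combination of earlier
  terms, yields a finitely supported \<open>d\<close> in \<open>S\<close> whose series sums to
  \<open>f\<close> in \<open>F\<close>. Lineability makes \<open>f\<close> zero, and independence
  then contradicts \<open>d n = 1\<close>.\<close>

lemma lineable_imp_infinite_codim:
  assumes F: "subspace F" and S: "c_null \<subseteq> S"
    and ind: "seq_independent smul S x" and lin: "seq_lineable smul x S (UNIV - F)"
  shows "\<not> finite_codim smul F"
proof -
  have "x n \<notin> span (F \<union> x ` {..<n})" for n
  proof
    assume "x n \<in> span (F \<union> x ` {..<n})"
    then obtain f s where fs: "f \<in> F" "s \<in> span (x ` {..<n})" "x n = f + s"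
      by (rule in_span_UnE[OF F])
    have "\<exists>c. s = (\<Sum>i<m. smul (c i) (x i))" if "s \<in> span (x ` {..<m})" for m s
      using that
    proof (induction m arbitrary: s)
      case (Suc m)
      then obtain k where "s - smul k (x m) \<in> span (x ` {..<m})"
        by (auto simp: lessThan_Suc span_breakdown_eq)
      then obtain c where "s - smul k (x m) = (\<Sum>i<m. smul (c i) (x i))" using Suc.IH by blast
      then have "s = (\<Sum>i<Suc m. smul ((c(m := k)) i) (x i))"
        by (simp add: diff_eq_eq)
      then show ?case by blast
    qed simp
    then obtain c where c: "s = (\<Sum>i<n. smul (c i) (x i))" using fs by blast
    define d where "d i = (if i < n then - c i else if i = n then 1 else 0)" for i
    have d0: "d i = 0" if "i > n" for i using that by (simp add: d_def)
    have "eventually (\<lambda>i. d i = 0) sequentially"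
      using eventually_gt_at_top[of n] by (rule eventually_mono) (rule d0)
    then have "d \<in> S" using S by (auto simp: c_null_def tendsto_eventually)
    have "(\<lambda>i. smul (d i) (x i)) sums (\<Sum>i\<le>n. smul (d i) (x i))"
      by (intro sums_finite) (auto simp: d0)
    also have "(\<Sum>i\<le>n. smul (d i) (x i)) = f"
      using fs(3) c by (simp add: d_def lessThan_Suc_atMost[symmetric] sum_negf)
    finally have sums: "(\<lambda>i. smul (d i) (x i)) sums f" .
    moreover obtain y where "y \<in> (UNIV - F) \<union> {0}" "(\<lambda>i. smul (d i) (x i)) sums y"
      using lin \<open>d \<in> S\<close> by (auto simp: seq_lineable_def)
    ultimately have "f = 0" using fs(1) sums_unique2 by blast
    then have "d n = 0" using ind sums \<open>d \<in> S\<close> by (auto simp: seq_independent_def)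
    then show False by (simp add: d_def)
  qed
  then have "span (F \<union> B) \<noteq> UNIV" if "finite B" for B
    using not_subset_span_Un_finite[OF that, of x F] by auto
  then show ?thesis using finite_codim_iff[OF F] by auto
qed

section \<open>Functionals and their common kernels\<close>

lemma functional_linear:
  assumes "functional f"
  shows "f (x + y) = f x + f y" "f (x - y) = f x - f y" "f (smul a x) = a * f x" "f 0 = 0"
  using assms bounded_linear.linear[of f]
  by (auto simp: functional_def linear_add linear_diff linear_0)

lemma subspace_kernel: "functional f \<Longrightarrow> subspace {x. f x = 0}"
  by (auto simp: subspace_def functional_linear)

lemma closed_kernel: "functional f \<Longrightarrow> closed {x. f x = 0}"
  unfolding functional_def
  by (intro closed_Collect_eq linear_continuous_on continuous_on_const) auto

text \<open>For subspaces this says that the image of \<open>X\<close> in the quotient by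
  \<open>F\<close> has infinite dimension. It is relative to \<open>X\<close> because vectors will
  be picked in a separable subspace.\<close>

definition infinite_mod :: "'e set \<Rightarrow> 'e set \<Rightarrow> bool"
  where "infinite_mod F X \<longleftrightarrow> (\<forall>B. finite B \<longrightarrow> \<not> X \<subseteq> span (F \<union> B))"

text \<open>The kernel of \<open>f\<close> in \<open>X\<close> has codimension at most one, so
  adding a single vector \<open>z\<close> to \<open>B\<close> recovers all of
  \<open>X\<close>.\<close>

lemma infinite_mod_kernel:
  assumes X: "subspace X" "infinite_mod F X" and f: "functional f"
  shows "infinite_mod F (X \<inter> {x. f x = 0})"
  unfolding infinite_mod_def
proof safe
  fix B assume B: "finite B" "X \<inter> {x. f x = 0} \<subseteq> span (F \<union> B)"
  have "\<not> X \<subseteq> span (F \<union> B)" using X B(1) by (simp add: infinite_mod_def)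
  then obtain z where z: "z \<in> X" "f z \<noteq> 0" using B(2) by auto
  have "x \<in> span (F \<union> insert z B)" if x: "x \<in> X" for x
  proof -
    have "x - smul (f x / f z) z \<in> X \<inter> {x. f x = 0}"
      using x z by (auto intro!: subspace_diff subspace_scale X(1) simp: functional_linear[OF f])
    then have "x - smul (f x / f z) z \<in> span (F \<union> B)" using B(2) by blast
    then show ?thesis unfolding Un_insert_right span_breakdown_eq by blast
  qed
  then have "X \<subseteq> span (F \<union> insert z B)" by blast
  then show False using X(2) B(1) unfolding infinite_mod_def by blast
qed

lemma infinite_mod_common_kernel:
  assumes X: "subspace X" "infinite_mod F X" and \<Phi>: "finite \<Phi>" "\<And>f. f \<in> \<Phi> \<Longrightarrow> functional f"
  obtains x where "x \<in> X" "x \<notin> F" "\<And>f. f \<in> \<Phi> \<Longrightarrow> f x = 0"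
proof -
  have "subspace (X \<inter> {x. \<forall>f\<in>\<Phi>. f x = 0}) \<and> infinite_mod F (X \<inter> {x. \<forall>f\<in>\<Phi>. f x = 0})"
    using \<Phi>
  proof (induction \<Phi>)
    case empty
    then show ?case using X by simp
  next
    case (insert f \<Phi>)
    have "X \<inter> {x. \<forall>f\<in>insert f \<Phi>. f x = 0} = (X \<inter> {x. \<forall>f\<in>\<Phi>. f x = 0}) \<inter> {x. f x = 0}"
      by auto
    with insert show ?case
      by (metis (no_types, lifting) infinite_mod_kernel insertCI subspace_inter subspace_kernel)
  qed
  \<comment> \<open>Already the choice of the empty set for \<open>B\<close> gives a vector outside
    \<open>F\<close>.\<close>
  then have "\<not> X \<inter> {x. \<forall>f\<in>\<Phi>. f x = 0} \<subseteq> span (F \<union> {})"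
    unfolding infinite_mod_def by blast
  then show ?thesis using that span_superset[of F] by auto
qed

end

subsection \<open>Subspaces of infinite codimension\<close>

lemma subspace_l_infinity: "module.subspace seq_scale (l_infinity :: (nat \<Rightarrow> 'k::real_normed_field) set)"
proof -
  interpret s: vector_space "seq_scale :: 'k \<Rightarrow> _"
    by unfold_locales (auto simp: seq_scale_def algebra_simps fun_eq_iff)
  have "bounded (range (\<lambda>n. c n + d n))" if "bounded (range c)" "bounded (range d)" for c d :: "nat \<Rightarrow> 'k"
    using bounded_plus[OF that] by (rule bounded_subset) auto
  moreover have "bounded (range (\<lambda>n. a * c n))" if "bounded (range c)" for a and c :: "nat \<Rightarrow> 'k"
  proof -
    have "range (\<lambda>n. a * c n) = (*) a ` range c" by auto
    then show ?thesis
      using bounded_linear_image[OF that bounded_linear_mult_right[of a]] by simp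
  qed
  ultimately show ?thesis
    by (auto simp: s.subspace_def l_infinity_def seq_scale_def plus_fun_def zero_fun_def)
qed

lemma closed_subspace_l_infinity_l_infinity:
  "closed_subspace_l_infinity (l_infinity :: (nat \<Rightarrow> 'k::real_normed_field) set)"
proof -
  have "apply_bcontfun f \<in> l_infinity" for f :: "nat \<Rightarrow>\<^sub>C 'k"
    using bounded_apply_bcontfun[of f] by (simp add: l_infinity_def)
  then show ?thesis by (simp add: closed_subspace_l_infinity_def subspace_l_infinity)
qed

lemma c_null_subset_l_infinity: "c_null \<subseteq> l_infinity"
  by (auto simp: c_null_def l_infinity_def intro: convergent_imp_bounded)

context hahn_banach_space
begin

lemma tendsto_smul:
  assumes "(h \<longlongrightarrow> x) A"
  shows "((\<lambda>n. smul c (h n)) \<longlongrightarrow> smul c x) A"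
proof -
  have "bounded_linear (smul c)"
  proof (rule bounded_linear_intro)
    show "smul c (r *\<^sub>R x) = r *\<^sub>R smul c x" for r x
      by (simp add: scale_left_commute flip: scale_of_real)
    show "norm (smul c x) \<le> norm x * norm c" for x by (simp add: norm_scale)
  qed (rule scale_right_distrib)
  then show ?thesis using assms by (rule bounded_linear.tendsto)
qed

lemma separating_functional:
  assumes F: "subspace F" "closed F" and w: "w \<notin> F"
  shows "\<exists>f. functional f \<and> (\<forall>x\<in>F. f x = 0) \<and> f w \<noteq> 0"
proof -
  obtain f where f: "functional f" "\<And>x. norm (f x) \<le> 2 * infdist x F" "infdist w F \<le> norm (f w)"
    using separation[OF F(1), of w] by blast
  have "infdist w F > 0"
    using F w subspace_0[OF F(1)] by (intro infdist_pos_not_in_closed) auto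
  moreover have "f x = 0" if "x \<in> F" for x using f(2)[of x] that by simp
  ultimately show ?thesis using f by force
qed

lemma span_subset_closure_countable:
  fixes u :: "nat \<Rightarrow> 'e"
  shows "\<exists>D. countable D \<and> span (u ` {..<n}) \<subseteq> closure D"
proof (induction n)
  case 0
  show ?case by (intro exI[of _ "{0}"]) auto
next
  case (Suc n)
  then obtain D where D: "countable D" "span (u ` {..<n}) \<subseteq> closure D" by blast
  \<comment> \<open>Second countability of \<open>'k\<close> provides countably many scalars to
    approximate the coefficient of the new generator.\<close>
  obtain C :: "'k set" where C: "countable C" "\<And>X. open X \<Longrightarrow> X \<noteq> {} \<Longrightarrow> \<exists>d\<in>C. d \<in> X"
    using countable_dense_setE by blast
  define D' where "D' = (\<lambda>(a, d). smul a (u n) + d) ` (C \<times> D)"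
  have "x \<in> closure D'" if x: "x \<in> span (u ` {..<Suc n})" for x
  proof -
    from x obtain k where k: "x - smul k (u n) \<in> span (u ` {..<n})"
      by (auto simp: lessThan_Suc span_breakdown_eq)
    show ?thesis unfolding closure_approachable
    proof (intro allI impI)
      fix e :: real assume e: "e > 0"
      obtain d where d: "d \<in> D" "dist d (x - smul k (u n)) < e / 2"
        using subsetD[OF D(2) k] e unfolding closure_approachable by (meson half_gt_zero)
      \<comment> \<open>The summand \<open>1\<close> keeps the denominator positive when
        \<open>u n = 0\<close>.\<close>
      have pos: "e / (2 * (1 + norm (u n))) > 0"
        using e by (intro divide_pos_pos) (auto intro: add_pos_nonneg)
      then obtain a where a: "a \<in> C" "dist a k < e / (2 * (1 + norm (u n)))"
        using C(2)[of "ball k (e / (2 * (1 + norm (u n))))"] by (auto simp: dist_commute)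
      have "norm (smul (a - k) (u n)) \<le> dist a k * (1 + norm (u n))"
        by (simp add: norm_scale dist_norm mult_left_mono)
      also have "\<dots> < e / 2"
        using a(2) by (simp add: field_simps add_pos_nonneg)
      finally have 1: "norm (smul (a - k) (u n)) < e / 2" .
      have "dist (smul a (u n) + d) x = norm (smul (a - k) (u n) + (d - (x - smul k (u n))))"
        by (simp add: dist_norm scale_left_diff_distrib algebra_simps)
      also have "\<dots> < e / 2 + e / 2"
        using 1 d(2) by (intro norm_add_less) (auto simp: dist_norm)
      finally have "dist (smul a (u n) + d) x < e" by simp
      moreover have "smul a (u n) + d \<in> D'" using a(1) d(1) by (auto simp: D'_def)
      ultimately show "\<exists>y\<in>D'. dist y x < e" by blast
    qed
  qed
  moreover have "countable D'" using C(1) D(1) by (auto simp: D'_def)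
  ultimately show ?case by blast
qed

text \<open>Norming functionals of a countable dense set suffice: if the one for \<open>d\<close>
  vanishes at \<open>x\<close>, then \<open>norm d\<close> is at most \<open>2 * dist d x\<close>,
  so points \<open>d\<close> close to \<open>x\<close> force \<open>norm x\<close> to be
  small.\<close>

lemma total_functionals:
  fixes u :: "nat \<Rightarrow> 'e"
  shows "\<exists>g. (\<forall>n::nat. functional (g n)) \<and>
    (\<forall>x\<in>closure (span (range u)). (\<forall>n. g n x = 0) \<longrightarrow> x = 0)"
proof -
  obtain D where D: "\<And>n. countable (D n)" "\<And>n. span (u ` {..<n}) \<subseteq> closure (D n)"
    using span_subset_closure_countable[of u] by metis
  \<comment> \<open>The \<open>0\<close> makes \<open>E\<close> nonempty, as its enumeration by
    \<open>from_nat_into\<close> requires.\<close>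
  define E where "E = insert 0 (\<Union>n. D n)"
  have "countable E" using D(1) by (auto simp: E_def)
  have "range u \<subseteq> (\<Union>n. span (u ` {..<n}))"
  proof (intro image_subsetI UN_I)
    show "u n \<in> span (u ` {..<Suc n})" for n by (intro span_base imageI) simp
  qed simp
  moreover have "subspace (\<Union>n. span (u ` {..<n}))"
  proof (rule subspaceI)
    fix x y assume "x \<in> (\<Union>n. span (u ` {..<n}))" "y \<in> (\<Union>n. span (u ` {..<n}))"
    then obtain n m where "x \<in> span (u ` {..<n})" "y \<in> span (u ` {..<m})" by blast
    then have "x \<in> span (u ` {..<max n m})" "y \<in> span (u ` {..<max n m})"
      by (meson image_mono lessThan_subset_iff max.cobounded1 max.cobounded2 span_mono subsetD)+
    then have "x + y \<in> span (u ` {..<max n m})" by (rule span_add)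
    then show "x + y \<in> (\<Union>n. span (u ` {..<n}))" by blast
  qed (auto intro: span_zero span_scale)
  ultimately have "span (range u) \<subseteq> (\<Union>n. span (u ` {..<n}))" by (rule span_minimal)
  also have "\<dots> \<subseteq> closure E"
    using D(2) closure_mono[of "D _" E] by (fastforce simp: E_def)
  finally have dense: "closure (span (range u)) \<subseteq> closure E"
    by (simp add: closure_minimal)
  \<comment> \<open>Separation from the zero subspace, the distance to which is the norm.\<close>
  have "\<exists>f. functional f \<and> (\<forall>x. norm (f x) \<le> 2 * norm x) \<and> norm w \<le> norm (f w)" for w
    using separation[OF subspace_single_0, of w] by simp
  then obtain s where s: "\<And>w. functional (s w)" "\<And>w x. norm (s w x) \<le> 2 * norm x"
      "\<And>w. norm w \<le> norm (s w w)"
    by metis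
  have "x = 0" if x: "x \<in> closure (span (range u))" and 0: "\<forall>d\<in>E. s d x = 0" for x
  proof -
    have "norm x \<le> 0 + e" if e: "e > 0" for e
    proof -
      obtain d where d: "d \<in> E" "dist d x < e / 3"
        using subsetD[OF dense x] e unfolding closure_approachable
        by (meson divide_pos_pos zero_less_numeral)
      have "norm d \<le> norm (s d d)" by (rule s)
      also have "\<dots> = norm (s d (d - x))" using 0 d(1) by (simp add: functional_linear[OF s(1)])
      also have "\<dots> \<le> 2 * norm (d - x)" by (rule s)
      finally have "norm d \<le> 2 * dist d x" by (simp add: dist_norm)
      moreover have "norm x \<le> norm d + dist d x"
        using norm_triangle_sub[of x d] by (simp add: dist_norm norm_minus_commute)
      ultimately show ?thesis using d(2) by simp
    qed
    then have "norm x \<le> 0" by (rule field_le_epsilon)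
    then show ?thesis by simp
  qed
  moreover have "range (from_nat_into E) = E"
    using \<open>countable E\<close> by (intro range_from_nat_into) (auto simp: E_def)
  ultimately show ?thesis
    using s(1) by (intro exI[of _ "\<lambda>n. s (from_nat_into E n)"]) (metis rangeE)
qed

end

text \<open>The matrix \<open>f n (w m)\<close> is triangular with nonzero diagonal, so the
  \<open>f n\<close> determine coefficients modulo \<open>F\<close> in increasing order of index.
  The \<open>g n\<close> need not vanish on \<open>F\<close>; they recognise \<open>0\<close> in the
  closed span of \<open>w\<close>.\<close>

locale triangular_system =
  hahn_banach_space smul
  for smul :: "'k::{real_normed_field,second_countable_topology} \<Rightarrow> 'e::banach \<Rightarrow> 'e" +
  fixes F :: "'e set" and f :: "nat \<Rightarrow> 'e \<Rightarrow> 'k" and w :: "nat \<Rightarrow> 'e"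
    and g :: "nat \<Rightarrow> 'e \<Rightarrow> 'k"
  assumes F: "subspace F"
    and f: "functional (f n)" "x \<in> F \<Longrightarrow> f n x = 0" "f n (w n) \<noteq> 0"
    and fw: "n < m \<Longrightarrow> f n (w m) = 0"
    and g: "functional (g n)"
    and gw: "n < m \<Longrightarrow> g n (w m) = 0"
    and total: "x \<in> closure (span (range w)) \<Longrightarrow> (\<And>n. g n x = 0) \<Longrightarrow> x = 0"

context hahn_banach_space
begin

text \<open>Vectors outside \<open>F\<close> are picked one after another in the common kernel of the functionals
  \<open>f i\<close> separating the earlier ones from \<open>F\<close> and of the first few members \<open>g i\<close> of a total
  sequence of functionals.\<close>

lemma ex_triangular_system:
  assumes F: "subspace F" "closed F" and inf: "\<not> finite_codim smul F"
  shows "\<exists>f w g. triangular_system smul F f w g"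
proof -
  have "\<exists>u. \<forall>n::nat. u n \<notin> span (F \<union> u ` {..<n})"
  proof (rule dependent_wellorder_choice)
    fix n :: nat and u
    have "span (F \<union> u ` {..<n}) \<noteq> UNIV" using inf finite_codim_iff[OF F(1)] by blast
    then show "\<exists>r. r \<notin> span (F \<union> u ` {..<n})" by auto
  next
    fix r :: 'e and u v :: "nat \<Rightarrow> 'e" and n assume "\<And>m. m < n \<Longrightarrow> u m = v m"
    then have "u ` {..<n} = v ` {..<n}" by (intro image_cong) auto
    then show "(r \<notin> span (F \<union> u ` {..<n})) = (r \<notin> span (F \<union> v ` {..<n}))" by simp
  qed
  then obtain u where u: "\<And>n::nat. u n \<notin> span (F \<union> u ` {..<n})" by auto
  \<comment> \<open>The vectors \<open>w n\<close> are to lie in \<open>X\<close>, whose closure is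
    separable; thus the total family \<open>g\<close> is available before \<open>w\<close> is
    chosen.\<close>
  define X where "X = span (range u)"
  have X: "subspace X" by (simp add: X_def)
  have infX: "infinite_mod F X"
    using not_subset_span_Un_finite[of _ u F, OF _ u] span_superset[of "range u"]
    unfolding infinite_mod_def X_def by blast
  obtain g where g: "\<And>n::nat. functional (g n)"
      "\<And>x. x \<in> closure X \<Longrightarrow> (\<And>n. g n x = 0) \<Longrightarrow> x = 0"
    using total_functionals[of u] unfolding X_def by metis
  obtain s where s: "\<And>z. z \<notin> F \<Longrightarrow> functional (s z)" "\<And>z x. z \<notin> F \<Longrightarrow> x \<in> F \<Longrightarrow> s z x = 0"
      "\<And>z. z \<notin> F \<Longrightarrow> s z z \<noteq> 0"
    using separating_functional[OF F] by metis
  have "\<exists>w. \<forall>n::nat. w n \<in> X \<and> w n \<notin> F \<and> (\<forall>i<n. s (w i) (w n) = 0 \<and> g i (w n) = 0)"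
  proof (rule dependent_wellorder_choice)
    fix n :: nat and w
    assume w: "\<And>m. m < n \<Longrightarrow> w m \<in> X \<and> w m \<notin> F \<and> (\<forall>i<m. s (w i) (w m) = 0 \<and> g i (w m) = 0)"
    obtain r where "r \<in> X" "r \<notin> F"
        "\<And>h. h \<in> (\<lambda>i. s (w i)) ` {..<n} \<union> g ` {..<n} \<Longrightarrow> h r = 0"
    proof (rule infinite_mod_common_kernel[OF X infX])
      show "functional h" if "h \<in> (\<lambda>i. s (w i)) ` {..<n} \<union> g ` {..<n}" for h
        using that w s(1) g(1) by auto
    qed auto
    then show "\<exists>r. r \<in> X \<and> r \<notin> F \<and> (\<forall>i<n. s (w i) r = 0 \<and> g i r = 0)" by blast
  qed simp
  then obtain w where w: "\<And>n::nat. w n \<in> X" "\<And>n. w n \<notin> F"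
      "\<And>i n. i < n \<Longrightarrow> s (w i) (w n) = 0" "\<And>i n. i < n \<Longrightarrow> g i (w n) = 0"
    by metis
  have sub: "closure (span (range w)) \<subseteq> closure X"
    using w(1) X by (intro closure_mono span_minimal) auto
  have "triangular_system smul F (\<lambda>n. s (w n)) w g"
  proof
    show "x = 0" if "x \<in> closure (span (range w))" "\<And>n. g n x = 0" for x
      using subsetD[OF sub that(1)] that(2) by (rule g(2))
  qed (simp_all add: F s w g(1))
  then show ?thesis by blast
qed

end

section \<open>Spaceability and lineability from a triangular system\<close>

context triangular_system
begin

lemma notin_span: "w n \<notin> span (F \<union> w ` {..<n})"
proof
  have *: "x \<in> F" if "x \<in> span (F \<union> w ` {..<n})" "\<And>i. i < n \<Longrightarrow> f i x = 0" for x n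
    using that
  proof (induction n arbitrary: x)
    case 0
    then show ?case by (simp add: span_eq_iff[THEN iffD2, OF F])
  next
    case (Suc n)
    from Suc.prems(1) obtain k where k: "x - smul k (w n) \<in> span (F \<union> w ` {..<n})"
      by (auto simp: lessThan_Suc span_breakdown_eq)
    \<comment> \<open>The earlier functionals kill \<open>w n\<close> as well, so the induction
      hypothesis applies to the difference. Evaluating \<open>f n\<close> on it then gives
      \<open>k = 0\<close>.\<close>
    have "x - smul k (w n) \<in> F"
      using Suc.prems(2) fw by (intro Suc.IH k) (simp add: functional_linear[OF f(1)])
    then have "f n (x - smul k (w n)) = 0" by (rule f(2))
    then have "k = 0" using Suc.prems(2)[of n] f(3)[of n] by (simp add: functional_linear[OF f(1)])
    then show ?case using \<open>x - smul k (w n) \<in> F\<close> by simp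
  qed
  assume "w n \<in> span (F \<union> w ` {..<n})"
  then have "w n \<in> F" using fw by (rule *)
  then show False using f(2,3) by blast
qed

lemma spaceable_compl: "spaceable smul (UNIV - F)"
proof -
  define W where "W = closure (span (range w))"
  have "subspace W" unfolding W_def
  proof (rule subspaceI)
    show "0 \<in> closure (span (range w))" using closure_subset span_zero by blast
    fix x y assume "x \<in> closure (span (range w))" "y \<in> closure (span (range w))"
    then obtain a b where ab: "\<And>n. a n \<in> span (range w)" "a \<longlonglongrightarrow> x"
        "\<And>n. b n \<in> span (range w)" "b \<longlonglongrightarrow> y"
      unfolding closure_sequential by blast
    then have "(\<lambda>n. a n + b n) \<longlonglongrightarrow> x + y" by (intro tendsto_add)
    moreover have "a n + b n \<in> span (range w)" for n using ab by (intro span_add)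
    ultimately show "x + y \<in> closure (span (range w))"
      unfolding closure_sequential by (intro exI[of _ "\<lambda>n. a n + b n"]) simp
  next
    fix c x assume "x \<in> closure (span (range w))"
    then obtain a where a: "\<And>n. a n \<in> span (range w)" "a \<longlonglongrightarrow> x"
      unfolding closure_sequential by blast
    then have "(\<lambda>n. smul c (a n)) \<longlonglongrightarrow> smul c x" by (intro tendsto_smul) auto
    moreover have "smul c (a n) \<in> span (range w)" for n using a by (intro span_scale)
    ultimately show "smul c x \<in> closure (span (range w))"
      unfolding closure_sequential by (intro exI[of _ "\<lambda>n. smul c (a n)"]) simp
  qed
  moreover have "\<not> finite_dim smul W"
  proof
    assume "finite_dim smul W"
    then obtain B where B: "finite B" "span B = W" by (auto simp: finite_dim_def)
    have "range w \<subseteq> W"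
      unfolding W_def by (rule order_trans[OF span_superset closure_subset])
    also have "\<dots> \<subseteq> span (F \<union> B)" unfolding B(2)[symmetric] by (rule span_mono) simp
    finally show False
      using not_subset_span_Un_finite[OF B(1) notin_span] by simp
  qed
  moreover have "x = 0" if x: "x \<in> W" "x \<in> F" for x
  proof (rule total)
    show "x \<in> closure (span (range w))" using x(1) by (simp add: W_def)
    \<comment> \<open>The coefficient of \<open>w n\<close> in an approximating sequence
      \<open>a\<close> is \<open>f n (a j) / f n (w n)\<close>, which tends to \<open>0\<close>
      because \<open>f n x = 0\<close>. Dropping that term does not change the limit.\<close>
    have tail: "x \<in> closure (span (w ` {n..}))" for n
    proof (induction n)
      case 0
      then show ?case using x(1) by (simp add: W_def)
    next
      case (Suc n)
      then obtain a where a: "\<And>j. a j \<in> span (w ` {n..})" "a \<longlonglongrightarrow> x"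
        unfolding closure_sequential by blast
      have "w ` {n..} = insert (w n) (w ` {Suc n..})"
        by (auto simp: image_iff) (metis atLeast_iff le_antisym not_less_eq_eq)
      then have "\<exists>k. a j - smul k (w n) \<in> span (w ` {Suc n..})" for j
        using a(1)[of j] by (simp add: span_breakdown_eq)
      then obtain k where k: "\<And>j. a j - smul (k j) (w n) \<in> span (w ` {Suc n..})" by metis
      have "span (w ` {Suc n..}) \<subseteq> {z. f n z = 0}"
        using fw by (intro span_minimal subspace_kernel f) auto
      then have "f n (a j - smul (k j) (w n)) = 0" for j using k[of j] by blast
      then have keq: "k j = f n (a j) / f n (w n)" for j
        using f(3)[of n] by (simp add: functional_linear[OF f(1)] field_simps)
      have "(\<lambda>j. f n (a j)) \<longlonglongrightarrow> f n x"
        using f(1)[of n] a(2) by (auto simp: functional_def intro: bounded_linear.tendsto)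
      then have "(\<lambda>j. f n (a j) / f n (w n)) \<longlonglongrightarrow> 0 / f n (w n)"
        using f(2)[OF x(2)] f(3) by (intro tendsto_divide) auto
      then have "k \<longlonglongrightarrow> 0" by (simp add: keq[abs_def])
      then have "(\<lambda>j. norm (k j) * norm (w n)) \<longlonglongrightarrow> 0"
        by (intro tendsto_mult_left_zero tendsto_norm_zero)
      then have "(\<lambda>j. smul (k j) (w n)) \<longlonglongrightarrow> 0"
        unfolding norm_scale[symmetric] by (rule tendsto_norm_zero_cancel)
      then have "(\<lambda>j. a j - smul (k j) (w n)) \<longlonglongrightarrow> x - 0"
        by (intro tendsto_diff a(2))
      with k show ?case
        unfolding closure_sequential by (intro exI[of _ "\<lambda>j. a j - smul (k j) (w n)"]) simp
    qed
    \<comment> \<open>\<open>g n\<close> kills every \<open>w m\<close> with \<open>m > n\<close>,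
      hence the closed span of that tail, which contains \<open>x\<close>.\<close>
    show "g n x = 0" for n
    proof -
      have "span (w ` {Suc n..}) \<subseteq> {z. g n z = 0}"
        using gw by (intro span_minimal subspace_kernel g) auto
      then have "closure (span (w ` {Suc n..})) \<subseteq> {z. g n z = 0}"
        by (intro closure_minimal closed_kernel g)
      with tail[of "Suc n"] show ?thesis by blast
    qed
  qed
  ultimately show ?thesis
    unfolding spaceable_def by (intro exI[of _ W]) (auto simp: W_def)
qed

lemma lineable_compl:
  "\<exists>x. seq_independent smul l_infinity x \<and> seq_lineable smul x l_infinity (UNIV - F)"
proof -
  \<comment> \<open>This scaling gives \<open>norm (x n) \<le> (1 / 2) ^ n\<close>, so every bounded
    coefficient sequence yields an absolutely convergent series.\<close>
  define t where "t n = inverse (2 ^ n * (1 + norm (w n)))" for n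
  define x where "x n = smul (of_real (t n)) (w n)" for n
  have pos: "2 ^ n * (1 + norm (w n)) > 0" for n by (simp add: add_pos_nonneg)
  have t: "t n > 0" for n unfolding t_def using pos[of n] by (rule positive_imp_inverse_positive)
  have norm_x: "norm (x n) \<le> (1 / 2) ^ n" for n
  proof -
    have "norm (x n) = t n * norm (w n)" using t[of n] by (simp add: x_def norm_scale)
    also have "\<dots> \<le> t n * (1 + norm (w n))" using t[of n] by simp
    also have "\<dots> = (1 / 2) ^ n"
    proof -
      have "1 + norm (w n) \<noteq> 0" using norm_ge_zero[of "w n"] by linarith
      then show ?thesis by (simp add: t_def power_one_over inverse_eq_divide)
    qed
    finally show ?thesis .
  qed
  have fx: "f n (x n) \<noteq> 0" "n < m \<Longrightarrow> f n (x m) = 0" for n m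
    using f(3)[of n] fw[of n m] t[of n] by (simp_all add: x_def functional_linear[OF f(1)])
  have summable: "summable (\<lambda>n. smul (c n) (x n))" if c: "c \<in> l_infinity" for c
  proof -
    obtain K where K: "\<And>n. norm (c n) \<le> K" using c by (auto simp: l_infinity_def bounded_iff)
    have le: "norm (smul (c n) (x n)) \<le> K * (1 / 2) ^ n" for n
      unfolding norm_scale using K[of n] norm_x[of n]
      by (intro mult_mono) (auto intro: order_trans[OF norm_ge_zero])
    have "summable (\<lambda>n. K * (1 / 2) ^ n)"
      by (intro summable_mult summable_geometric) simp
    then show ?thesis by (rule summable_comparison_test') (rule le)
  qed
  \<comment> \<open>In \<open>f n y\<close> the terms with \<open>k < n\<close> vanish by induction
    and those with \<open>k > n\<close> by triangularity, which leaves
    \<open>c n * f n (x n) = f n y = 0\<close>. The case \<open>y = 0\<close> is independence; the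
    general case shows that a sum in \<open>F\<close> is \<open>0\<close>.\<close>
  have zero: "c n = 0" if "(\<lambda>n. smul (c n) (x n)) sums y" "y \<in> F" for c y n
  proof (induction n rule: less_induct)
    case (less n)
    have "bounded_linear (f n)" using f(1)[of n] by (simp add: functional_def)
    then have 1: "(\<lambda>k. f n (smul (c k) (x k))) sums f n y"
      using that(1) by (rule bounded_linear.sums)
    have "f n (smul (c k) (x k)) = 0" if "k \<noteq> n" for k
    proof -
      have "c k = 0 \<or> f n (x k) = 0" using that less[of k] fx(2)[of n k] by linarith
      then show ?thesis by (auto simp: functional_linear[OF f(1)])
    qed
    then have "(\<lambda>k. f n (smul (c k) (x k))) sums (\<Sum>k\<in>{n}. f n (smul (c k) (x k)))"
      by (intro sums_finite) auto
    from sums_unique2[OF 1 this] have "f n y = c n * f n (x n)"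
      by (simp add: functional_linear[OF f(1)])
    then show ?case using f(2)[OF that(2)] fx(1)[of n] by simp
  qed
  have "seq_independent smul l_infinity x"
    using zero subspace_0[OF F] by (auto simp: seq_independent_def)
  moreover have "seq_lineable smul x l_infinity (UNIV - F)"
    unfolding seq_lineable_def
  proof
    fix c :: "nat \<Rightarrow> 'k" assume "c \<in> l_infinity"
    then obtain y where y: "(\<lambda>n. smul (c n) (x n)) sums y"
      using summable by (auto simp: summable_def)
    have "y = 0" if "y \<in> F"
      using sums_unique2[OF y] by (simp add: zero[OF y that])
    with y show "\<exists>y\<in>UNIV - F \<union> {0}. (\<lambda>n. smul (c n) (x n)) sums y" by auto
  qed
  ultimately show ?thesis by blast
qed

end

context hahn_banach_space
begin

text \<open>Infinite codimension is the hub: it implies spaceability, and lineability with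
  \<open>S = l_infinity\<close>, by a triangular system, and each of the two implies it.\<close>

theorem lineable_iff_spaceable_iff_infinite_codim:
  assumes F: "subspace F" "closed F"
  shows "((\<exists>S x. closed_subspace_l_infinity S \<and> c_null \<subseteq> S \<and>
            seq_independent smul S x \<and> seq_lineable smul x S (UNIV - F))
          \<longleftrightarrow> spaceable smul (UNIV - F)) \<and>
         (spaceable smul (UNIV - F) \<longleftrightarrow> \<not> finite_codim smul F)"
  using ex_triangular_system[OF F] triangular_system.lineable_compl triangular_system.spaceable_compl
    lineable_imp_infinite_codim[OF F(1)] spaceable_imp_infinite_codim[OF F(1)]
    closed_subspace_l_infinity_l_infinity c_null_subset_l_infinity
  by meson

end

theorem corollary4p1:
  fixes F :: "'e::banach set"
    and scaleC :: "complex \<Rightarrow> 'f::banach \<Rightarrow> 'f"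
    and G :: "'f set"
  shows
    "(subspace F \<and> closed F \<and> \<not> finite_dim scaleR F \<longrightarrow>
       ((\<exists>(S :: (nat \<Rightarrow> real) set) (x :: nat \<Rightarrow> 'e).
            closed_subspace_l_infinity S \<and> c_null \<subseteq> S \<and>
            seq_independent scaleR S x \<and> seq_lineable scaleR x S (UNIV - F))
          \<longleftrightarrow> spaceable scaleR (UNIV - F)) \<and>
       (spaceable scaleR (UNIV - F) \<longleftrightarrow> \<not> finite_codim scaleR F))
     \<and>
     (banach_space_over scaleC \<and>
      module.subspace scaleC G \<and> closed G \<and> \<not> finite_dim scaleC G \<longrightarrow>
       ((\<exists>(S :: (nat \<Rightarrow> complex) set) (x :: nat \<Rightarrow> 'f).
            closed_subspace_l_infinity S \<and> c_null \<subseteq> S \<and>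
            seq_independent scaleC S x \<and> seq_lineable scaleC x S (UNIV - G))
          \<longleftrightarrow> spaceable scaleC (UNIV - G)) \<and>
       (spaceable scaleC (UNIV - G) \<longleftrightarrow> \<not> finite_codim scaleC G))"
proof (intro conjI[of "_ \<longrightarrow> _"] impI)
  assume "subspace F \<and> closed F \<and> \<not> finite_dim scaleR F"
  then have "module.subspace scaleR F" "closed F" by (simp_all add: subspace_raw_def)
  then show "((\<exists>(S :: (nat \<Rightarrow> real) set) (x :: nat \<Rightarrow> 'e).
            closed_subspace_l_infinity S \<and> c_null \<subseteq> S \<and>
            seq_independent scaleR S x \<and> seq_lineable scaleR x S (UNIV - F))
          \<longleftrightarrow> spaceable scaleR (UNIV - F)) \<and>
       (spaceable scaleR (UNIV - F) \<longleftrightarrow> \<not> finite_codim scaleR F)"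
    by (rule hahn_banach_space.lineable_iff_spaceable_iff_infinite_codim[OF hahn_banach_space_real])
next
  assume G: "banach_space_over scaleC \<and> module.subspace scaleC G \<and> closed G \<and> \<not> finite_dim scaleC G"
  then have "hahn_banach_space scaleC" by (intro hahn_banach_space_complex) simp
  then show "((\<exists>(S :: (nat \<Rightarrow> complex) set) (x :: nat \<Rightarrow> 'f).
            closed_subspace_l_infinity S \<and> c_null \<subseteq> S \<and>
            seq_independent scaleC S x \<and> seq_lineable scaleC x S (UNIV - G))
          \<longleftrightarrow> spaceable scaleC (UNIV - G)) \<and>
       (spaceable scaleC (UNIV - G) \<longleftrightarrow> \<not> finite_codim scaleC G)"
    using G by (intro hahn_banach_space.lineable_iff_spaceable_iff_infinite_codim) auto
qed

end
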